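(* Let $m>1$ be an integer. Define $sf(n,m)$ for integers $n$ by $sf(n,m)=0$ for $n<0$, $sf(0,m)=1$, and for $n>0$: $sf(n,m)=sf(n/m,m)$ if $n\equiv0\pmod m$, and $sf(n,m)=sf(n-r,m)+sf(n-m,m)$ if $n\equiv r\pmod m$ with $0<r<m$. Then for every integer $n\ge0$, $$sf(nm+1,m)=sf(nm+2,m)=\cdots=sf(nm+m-1,m)=\sum_{j=0}^{n}sf(j,m).$$
   Context: $sf(n,m)$ is the number of semi-$m$-Fibonacci partitions of $n$, characterized by the stated recurrence. *)

theory Defs
  imports Main
begin

text \<open>
  The recurrence is only meaningful for \<open>m > 1\<close>; for \<open>m \<le> 1\<close> and \<open>n > 0\<close> the value
  is a dummy 0, which makes the function total. The residue \<open>r\<close> is \<open>n mod m\<close>.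
\<close>

function sf :: "int \<Rightarrow> int \<Rightarrow> nat" where
  "sf n m =
    (if n < 0 then 0
     else if n = 0 then 1
     else if m \<le> 1 then 0
     else if n mod m = 0 then sf (n div m) m
     else sf (n - n mod m) m + sf (n - m) m)"
  by pat_completeness auto
termination
proof (relation "measure (\<lambda>(n, m). nat n)", goal_cases)
  case 1
  then show ?case by simp
next
  case (2 n m)
  then show ?case by (simp add: int_div_less_self)
next
  case (3 n m)
  then have "0 < n mod m"
    by (simp add: order_less_le)
  with 3 show ?case by simp
next
  case (4 n m)
  then show ?case by simp
qed

declare sf.simps [simp del]

lemma sf_neg: "n < 0 \<Longrightarrow> sf n m = 0"
  by (simp add: sf.simps)

lemma sf_zero: "sf 0 m = 1"
  by (simp add: sf.simps)

lemma sf_dvd: "m > 1 \<Longrightarrow> n > 0 \<Longrightarrow> n mod m = 0 \<Longrightarrow> sf n m = sf (n div m) m"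
  by (subst sf.simps) simp

lemma sf_residue:
  "m > 1 \<Longrightarrow> n > 0 \<Longrightarrow> n mod m = r \<Longrightarrow> 0 < r \<Longrightarrow> r < m \<Longrightarrow> sf n m = sf (n - r) m + sf (n - m) m"
  by (subst sf.simps) simp

end

theory Submission
  imports Defs
begin

text \<open>For \<open>0 < r < m\<close> the recurrence splits the value at \<open>n * m + r\<close>
  into the value at \<open>n * m\<close>, which collapses to \<open>sf n m\<close>
  (\<open>sf_mult\<close>), and the value at \<open>(n - 1) * m + r\<close>, with the same residue
  (\<open>sf_mult_add_residue\<close>). Iterating over \<open>n\<close> telescopes to the sum,
  whatever \<open>r\<close> is.\<close>

lemma sf_mult:
  assumes "m > 1" and "n \<ge> 0"
  shows "sf (n * m) m = sf n m"
proof (cases "n = 0")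
  case False
  with assms have "n * m > 0" by simp
  then show ?thesis using sf_dvd[of m "n * m"] assms by simp
qed simp

lemma sf_mult_add_residue:
  assumes "m > 1" and "n \<ge> 0" and "0 < r" and "r < m"
  shows "sf (n * m + r) m = sf n m + sf ((n - 1) * m + r) m"
proof -
  have "n * m + r > 0" using assms by (simp add: add_nonneg_pos)
  moreover have "(n * m + r) mod m = r" using assms by simp
  ultimately have "sf (n * m + r) m = sf (n * m + r - r) m + sf (n * m + r - m) m"
    using assms by (intro sf_residue) auto
  moreover have "n * m + r - m = (n - 1) * m + r" by (simp add: algebra_simps)
  ultimately show ?thesis using assms by (simp add: sf_mult)
qed

theorem theorem5:
  fixes m n :: int
  assumes "m > 1" and "n \<ge> 0"
  shows "\<forall>r\<in>{1..m - 1}. sf (n * m + r) m = (\<Sum>j=0..n. sf j m)"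
proof
  fix r assume "r \<in> {1..m - 1}"
  then have r: "0 < r" "r < m" by auto
  show "sf (n * m + r) m = (\<Sum>j=0..n. sf j m)"
    using \<open>n \<ge> 0\<close>
  proof (induction n rule: int_ge_induct)
    case base
    \<comment> \<open>The lower term sits at \<open>r - m < 0\<close>, where \<open>sf\<close>
      vanishes, so only \<open>sf 0 m\<close> remains.\<close>
    then show ?case
      using sf_mult_add_residue[of m 0 r] assms(1) r by (simp add: sf_neg)
  next
    case (step i)
    \<comment> \<open>The new summand \<open>sf (i + 1) m\<close> is exactly the increment given by
      the recurrence.\<close>
    have "{0..i + 1} = insert (i + 1) {0..i}" using step.hyps by auto
    then show ?case
      using sf_mult_add_residue[of m "i + 1" r] assms(1) r step by simp
  qed
qed

end
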